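(* It is not true that for every $A\in\mathcal{Z}$ the map $F_A$ is proper. That is, there exist a positive integer $m$ and an $m\times m$ matrix $A$ with real coefficients such that for every $\lambda\in\mathbb{R}$ the equation $x+\lambda (Ax)^3=0$ has $x=0$ as its only solution $x\in\mathbb{R}^m$, and yet the map $F_A:\mathbb{R}^m\to\mathbb{R}^m$, $F_A(x)=x+(Ax)^3$, is not proper.
   Context: For $x\in\mathbb{R}^m$, $x^3=(x_1^3,\ldots,x_m^3)$ denotes the coordinatewise cube. $\mathcal{Z}$ denotes the class of real square matrices $A$ (of any size $m\times m$) such that for every $\lambda\in\mathbb{R}$ the equation $x+\lambda(Ax)^3=0$ has only one solution $x=0$. A map is proper if the pre-image of every compact set is compact. *)

theory Defs
  imports "HOL-Analysis.Analysis" "Jordan_Normal_Form.Matrix"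
begin

no_notation vec_nth (infixl "$" 90)

text \<open>The dimension is quantified inside the statement, so points of R^m are vectors
  in \<^term>\<open>carrier_vec m\<close> and matrices are elements of \<^term>\<open>carrier_mat m m\<close>.
  The topology is pulled back along the coordinate map into \<^term>\<open>Euclidean_space m\<close>,
  whose points are the functions on the naturals that vanish from m onwards.\<close>

definition vec_coords :: "nat \<Rightarrow> real vec \<Rightarrow> nat \<Rightarrow> real" where
  "vec_coords m v = (\<lambda>i. if i < m then v $ i else 0)"

definition vec_space :: "nat \<Rightarrow> real vec topology" where
  "vec_space m = pullback_topology (carrier_vec m) (vec_coords m) (Euclidean_space m)"

lemma topspace_vec_space [simp]: "topspace (vec_space m) = carrier_vec m"
  by (auto simp: vec_space_def topspace_pullback_topology topspace_Euclidean_space vec_coords_def)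

lemma homeomorphic_map_vec_coords:
  "homeomorphic_map (vec_space m) (Euclidean_space m) (vec_coords m)"
proof -
  let ?g = "\<lambda>x. vec m (x :: nat \<Rightarrow> real)"
  have inv: "vec_coords m (?g x) = x" if "x \<in> topspace (Euclidean_space m)" for x
    using that by (auto simp: vec_coords_def topspace_Euclidean_space fun_eq_iff)
  have "continuous_map (vec_space m) (Euclidean_space m) (vec_coords m)"
    using continuous_map_pullback[OF continuous_map_id, of "carrier_vec m" "vec_coords m"]
    by (simp add: vec_space_def)
  moreover have "continuous_map (Euclidean_space m) (vec_space m) ?g"
    unfolding vec_space_def
  proof (rule continuous_map_pullback')
    have "continuous_map (Euclidean_space m) (Euclidean_space m) (\<lambda>x. x)"
      by simp
    then show "continuous_map (Euclidean_space m) (Euclidean_space m) (vec_coords m \<circ> ?g)"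
      by (rule continuous_map_eq) (simp add: inv)
  qed auto
  moreover have "?g (vec_coords m v) = v" if "v \<in> carrier_vec m" for v
    using that by (auto simp: vec_coords_def)
  ultimately have "homeomorphic_maps (vec_space m) (Euclidean_space m) (vec_coords m) ?g"
    using inv by (simp add: homeomorphic_maps_def)
  then show ?thesis
    by (rule homeomorphic_maps_map[THEN iffD1, THEN conjunct1])
qed

definition cube_vec :: "real vec \<Rightarrow> real vec" where
  "cube_vec v = map_vec (\<lambda>t. t ^ 3) v"

definition class_Z :: "real mat set" where
  "class_Z = {A. square_mat A \<and>
     (\<forall>c. {x \<in> carrier_vec (dim_row A).
            x + c \<cdot>\<^sub>v cube_vec (A *\<^sub>v x) = 0\<^sub>v (dim_row A)} = {0\<^sub>v (dim_row A)})}"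

definition cubic_map :: "real mat \<Rightarrow> real vec \<Rightarrow> real vec" where
  "cubic_map A x = x + cube_vec (A *\<^sub>v x)"

text \<open>The library's \<^const>\<open>proper_map\<close> means closed with compact fibres; here
  properness is compactness of preimages of compact sets.\<close>

definition compact_preimage_map :: "'a topology \<Rightarrow> 'b topology \<Rightarrow> ('a \<Rightarrow> 'b) \<Rightarrow> bool" where
  "compact_preimage_map X Y f \<longleftrightarrow>
     (\<forall>K. compactin Y K \<longrightarrow> compactin X {x \<in> topspace X. f x \<in> K})"

end

theory Submission
  imports Defs
begin

text \<open>Let e = (1,1,1) and w = (1,0,-1), so that w * w * w = w coordinatewise, and let A be the
  nilpotent 3 by 3 matrix with A e = 0, A w = e, A (w * w) = w. A point
  x = s^3 e - s w + (1/(3s)) w * w has A x = -s e + (1/(3s)) w, and cubing gives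
  x + (A x)^3 = (1/(27 s^3)) w. Hence the curve escapes to infinity while its image stays in a segment.

  On the other hand, if x + c (A x)^3 = 0 then y = A x = a e + b w satisfies y = -c A y^3, and
  A y^3 = (3 a^2 b + b^3) e + 3 a b^2 w; comparing coefficients forces a = b = 0.\<close>

definition nonproper_mat :: "real mat" where
  "nonproper_mat = mat_of_rows_list 3 [[1, -1, 0], [1/2, 0, -1/2], [0, 1, -1]]"

lemma nonproper_mat_carrier: "nonproper_mat \<in> carrier_mat 3 3"
  by (rule carrier_matI) (simp_all add: nonproper_mat_def mat_of_rows_list_def)

lemma nonproper_mat_mult_vec:
  assumes "x \<in> carrier_vec 3"
  shows "nonproper_mat *\<^sub>v x = vec_of_list [x $ 0 - x $ 1, (x $ 0 - x $ 2) / 2, x $ 1 - x $ 2]"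
proof (rule eq_vecI)
  fix i
  assume "i < dim_vec (vec_of_list [x $ 0 - x $ 1, (x $ 0 - x $ 2) / 2, x $ 1 - x $ 2])"
  then have i: "i = 0 \<or> i = 1 \<or> i = 2" and "i < 3"
    by auto
  have "{0..<3} = {0, 1, 2::nat}"
    by auto
  then have "(nonproper_mat *\<^sub>v x) $ i = (\<Sum>j\<in>{0, 1, 2}. nonproper_mat $$ (i, j) * x $ j)"
    using \<open>i < 3\<close> assms nonproper_mat_carrier by (simp add: scalar_prod_def)
  also have "\<dots> = vec_of_list [x $ 0 - x $ 1, (x $ 0 - x $ 2) / 2, x $ 1 - x $ 2] $ i"
    using i by (elim disjE)
      (simp_all add: nonproper_mat_def mat_of_rows_list_def vec_of_list_index numeral_2_eq_2 field_simps)
  finally show "(nonproper_mat *\<^sub>v x) $ i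
      = vec_of_list [x $ 0 - x $ 1, (x $ 0 - x $ 2) / 2, x $ 1 - x $ 2] $ i" .
qed (simp add: nonproper_mat_def mat_of_rows_list_def)

text \<open>Combining the three equations isolates the coordinates \<open>a\<close> and
  \<open>b\<close> of A x along e and w. With k = -3 c a b they read b = b k and a = a k - c b^3. If
  b were nonzero, then k = 1, so c b^3 = 0 and c = 0, against k = 1.\<close>

lemma nonproper_mat_eigen_system:
  fixes c x y z :: real
  assumes "x + c * (x - y) ^ 3 = 0" "y + c * ((x - z) / 2) ^ 3 = 0" "z + c * (y - z) ^ 3 = 0"
  shows "x = 0 \<and> y = 0 \<and> z = 0"
proof -
  \<comment> \<open>Chosen so that A (x, y, z) = (a + b, a, a - b) = a e + b w.\<close>
  define a b where "a = (x - z) / 2" and "b = (x - 2 * y + z) / 2"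
  have ab: "a + b = x - y" "a - b = y - z"
    by (simp_all add: a_def b_def field_simps)
  have x: "x = - c * (a + b) ^ 3" and y: "y = - c * a ^ 3" and z: "z = - c * (a - b) ^ 3"
    unfolding ab using assms by (simp_all add: a_def eq_neg_iff_add_eq_0)
  have "2 * a = x - z" and "2 * b = x - 2 * y + z"
    by (simp_all add: a_def b_def)
  \<comment> \<open>The second difference (a + b)^3 - 2 a^3 + (a - b)^3 collapses to 6 a
    b^2.\<close>
  have "x - 2 * y + z = 2 * (b * (- 3 * c * a * b))"
    unfolding x y z by (simp add: power3_eq_cube algebra_simps)
  then have b: "b = b * (- 3 * c * a * b)"
    using \<open>2 * b = x - 2 * y + z\<close> by (metis mult_cancel_left zero_neq_numeral)
  have "x - z = 2 * (a * (- 3 * c * a * b) - c * b ^ 3)"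
    unfolding x z by (simp add: power3_eq_cube algebra_simps)
  then have a: "a = a * (- 3 * c * a * b) - c * b ^ 3"
    using \<open>2 * a = x - z\<close> by (metis mult_cancel_left zero_neq_numeral)
  have "b = 0"
  proof (rule ccontr)
    assume "b \<noteq> 0"
    with b have 1: "- 3 * c * a * b = 1" by (metis mult_cancel_left1)
    with a \<open>b \<noteq> 0\<close> have "c = 0" by simp
    with 1 show False by simp
  qed
  with a have "a = 0" by simp
  with \<open>b = 0\<close> show ?thesis
    using x y z by simp
qed

text \<open>The scalar stays general to serve twice: arbitrary \<open>c\<close> for membership in
  \<open>class_Z\<close>, and \<open>c = 1\<close> for \<open>cubic_map\<close>.\<close>

lemma cubic_nonproper_mat:
  assumes "x \<in> carrier_vec 3"
  shows "x + c \<cdot>\<^sub>v cube_vec (nonproper_mat *\<^sub>v x) =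
    vec_of_list [x $ 0 + c * (x $ 0 - x $ 1) ^ 3, x $ 1 + c * ((x $ 0 - x $ 2) / 2) ^ 3,
      x $ 2 + c * (x $ 1 - x $ 2) ^ 3]" (is "?l = ?r")
proof (rule eq_vecI)
  fix i
  assume "i < dim_vec ?r"
  then have "i = 0 \<or> i = 1 \<or> i = 2"
    by auto
  then show "?l $ i = ?r $ i"
    using assms by (auto simp: nonproper_mat_mult_vec cube_vec_def vec_of_list_index numeral_2_eq_2)
qed (use assms in \<open>simp add: nonproper_mat_mult_vec cube_vec_def\<close>)

lemma nonproper_mat_class_Z: "nonproper_mat \<in> class_Z"
proof -
  have dim: "dim_row nonproper_mat = 3" "dim_col nonproper_mat = 3"
    using nonproper_mat_carrier by auto
  have "x = 0\<^sub>v 3"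
    if x: "x \<in> carrier_vec 3" and eq: "x + c \<cdot>\<^sub>v cube_vec (nonproper_mat *\<^sub>v x) = 0\<^sub>v 3" for c x
  proof -
    have comp: "vec_of_list [x $ 0 + c * (x $ 0 - x $ 1) ^ 3, x $ 1 + c * ((x $ 0 - x $ 2) / 2) ^ 3,
      x $ 2 + c * (x $ 1 - x $ 2) ^ 3] $ i = 0" if "i < 3" for i
      using eq that by (simp add: cubic_nonproper_mat[OF x])
    have "x $ 0 = 0 \<and> x $ 1 = 0 \<and> x $ 2 = 0"
      using comp[of 0] comp[of 1] comp[of 2]
      by (intro nonproper_mat_eigen_system[of _ c]) (simp_all add: vec_of_list_index numeral_2_eq_2)
    moreover have "i < 3 \<Longrightarrow> i = 0 \<or> i = 1 \<or> i = 2" for i :: nat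
      by auto
    ultimately show ?thesis
      using x by (intro eq_vecI) auto
  qed
  \<comment> \<open>\<open>class_Z\<close> asks for equality of the solution set with {0}, so zero
    must also be checked to be a solution.\<close>
  moreover have "0\<^sub>v 3 + c \<cdot>\<^sub>v cube_vec (nonproper_mat *\<^sub>v 0\<^sub>v 3) = 0\<^sub>v 3" for c
    by (rule eq_vecI)
      (auto simp: cubic_nonproper_mat vec_of_list_index less_Suc_eq numeral_3_eq_3 numeral_2_eq_2)
  ultimately show ?thesis
    by (auto simp: class_Z_def dim)
qed

text \<open>The topology is pulled back from a subspace of a product, where continuity is
  coordinatewise; the coordinates from \<open>m\<close> onwards are constantly 0.\<close>

lemma continuous_map_vec_spaceI:
  assumes "\<And>t. t \<in> topspace X \<Longrightarrow> f t \<in> carrier_vec m"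
    and "\<And>i. i < m \<Longrightarrow> continuous_map X euclideanreal (\<lambda>t. f t $ i)"
  shows "continuous_map X (vec_space m) f"
  unfolding vec_space_def
proof (rule continuous_map_pullback')
  have "continuous_map X euclideanreal (\<lambda>t. vec_coords m (f t) i)" for i
    using assms(2) by (cases "i < m") (simp_all add: vec_coords_def)
  then show "continuous_map X (Euclidean_space m) (vec_coords m \<circ> f)"
    by (auto simp: Euclidean_space_def continuous_map_in_subtopology continuous_map_componentwise_UNIV
        o_def vec_coords_def)
qed (use assms(1) in auto)

lemma continuous_map_vec_coord:
  assumes "i < m"
  shows "continuous_map (vec_space m) euclideanreal (\<lambda>v. v $ i)"
proof -
  have "continuous_map (vec_space m) (Euclidean_space m) (vec_coords m)"
    by (rule homeomorphic_imp_continuous_map[OF homeomorphic_map_vec_coords])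
  then have "continuous_map (vec_space m) euclideanreal (\<lambda>v. vec_coords m v i)"
    by (simp add: Euclidean_space_def continuous_map_in_subtopology
        continuous_map_componentwise_UNIV)
  with assms show ?thesis
    by (simp add: vec_coords_def)
qed

text \<open>A coordinate is continuous, so it sends a compact set to a compact, hence bounded, set
  of reals. This turns an unbounded coordinate into a failure of compactness.\<close>

lemma compact_coord_bounded:
  assumes "compactin (vec_space m) P" "i < m"
  obtains B where "\<And>v. v \<in> P \<Longrightarrow> \<bar>v $ i\<bar> \<le> B"
proof -
  have "compact ((\<lambda>v. v $ i) ` P)"
    using image_compactin[OF assms(1) continuous_map_vec_coord[OF assms(2)]] by simp
  then show ?thesis
    using that by (fastforce dest!: compact_imp_bounded simp: bounded_iff)
qed

text \<open>The coefficients come from seeking x with A x = a e + b w and x = -(a^3 e + 3 a^2 b w +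
  3 a b^2 w * w), so that only b^3 w survives in x + (A x)^3. Applying A to x, both coefficients
  demand 3 a b = -1; the curve takes a = -s and b = 1/(3s).\<close>

definition escaping_curve :: "real \<Rightarrow> real vec" where
  "escaping_curve s = vec_of_list [s ^ 3 - s + 1 / (3 * s), s ^ 3, s ^ 3 + s + 1 / (3 * s)]"

lemma escaping_curve_carrier: "escaping_curve s \<in> carrier_vec 3"
  by (rule carrier_vecI) (simp add: escaping_curve_def)

lemma cubic_map_escaping_curve:
  assumes "s \<noteq> 0"
  shows "cubic_map nonproper_mat (escaping_curve s)
    = vec_of_list [1 / (27 * s ^ 3), 0, - (1 / (27 * s ^ 3))]"
proof -
  have "cubic_map nonproper_mat (escaping_curve s)
      = escaping_curve s + 1 \<cdot>\<^sub>v cube_vec (nonproper_mat *\<^sub>v escaping_curve s)"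
    by (simp add: cubic_map_def)
  also have "\<dots> = vec_of_list [1 / (27 * s ^ 3), 0, - (1 / (27 * s ^ 3))]"
    unfolding cubic_nonproper_mat[OF escaping_curve_carrier]
    using assms
    by (simp add: escaping_curve_def vec_of_list_index numeral_2_eq_2)
      (simp add: field_simps power3_eq_cube)
  finally show ?thesis .
qed

lemma not_compact_preimage_nonproper_mat:
  "\<not> compact_preimage_map (vec_space 3) (vec_space 3) (cubic_map nonproper_mat)"
proof
  assume proper: "compact_preimage_map (vec_space 3) (vec_space 3) (cubic_map nonproper_mat)"
  \<comment> \<open>\<open>g\<close> runs along the line spanned by w; its values over [0, 1] form
    the compact segment whose preimage is tested.\<close>
  define g :: "real \<Rightarrow> real vec" where "g r = vec_of_list [r, 0, - r]" for r
  have "continuous_map euclideanreal (vec_space 3) g"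
  proof (rule continuous_map_vec_spaceI)
    show "g t \<in> carrier_vec 3" for t
      by (rule carrier_vecI) (simp add: g_def)
    fix i :: nat
    assume "i < 3"
    then have "i = 0 \<or> i = 1 \<or> i = 2" by auto
    then show "continuous_map euclideanreal euclideanreal (\<lambda>t. g t $ i)"
      by (auto simp: g_def vec_of_list_index numeral_2_eq_2 intro!: continuous_intros)
  qed
  then have "compactin (vec_space 3) (g ` {0..1})"
    by (rule image_compactin[rotated]) simp
  with proper have "compactin (vec_space 3) {x \<in> carrier_vec 3. cubic_map nonproper_mat x \<in> g ` {0..1}}"
    by (simp add: compact_preimage_map_def)
  \<comment> \<open>The middle coordinate is convenient: w and w * w vanish there, which leaves
    exactly s^3 on the curve.\<close>
  then obtain B where B: "\<And>v. v \<in> carrier_vec 3 \<Longrightarrow> cubic_map nonproper_mat v \<in> g ` {0..1} \<Longrightarrow> \<bar>v $ 1\<bar> \<le> B"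
    using compact_coord_bounded[of 3 _ 1] by (metis (lifting) mem_Collect_eq one_less_numeral_iff semiring_norm(77))
  \<comment> \<open>With s at least 1, the parameter 1/(27 s^3) lies in [0, 1] and s^3 is at least
    s; exceeding \<open>B\<close> then breaks the bound.\<close>
  define s where "s = \<bar>B\<bar> + 1"
  have s: "s \<ge> 1" "s > B" by (auto simp: s_def)
  then have s3: "s ^ 3 \<ge> s"
    by (simp add: self_le_power)
  have "cubic_map nonproper_mat (escaping_curve s) = g (1 / (27 * s ^ 3))"
    using s by (simp add: cubic_map_escaping_curve g_def)
  moreover have "1 / (27 * s ^ 3) \<in> {0..1}"
    using s s3 by (simp add: divide_simps)
  ultimately have "\<bar>escaping_curve s $ 1\<bar> \<le> B"
    by (intro B[OF escaping_curve_carrier]) auto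
  moreover have "escaping_curve s $ 1 = s ^ 3"
    by (simp add: escaping_curve_def vec_of_list_index)
  ultimately show False
    using s s3 by linarith
qed

theorem claim2:
  shows "\<exists>m>0. \<exists>A \<in> carrier_mat m m. A \<in> class_Z \<and>
    \<not> compact_preimage_map (vec_space m) (vec_space m) (cubic_map A)"
  using nonproper_mat_carrier nonproper_mat_class_Z not_compact_preimage_nonproper_mat
  by (intro exI[of _ 3]) auto

end
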